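(* Let $W$ be a real Hilbert space with a closed-nilpotent operator $\mathrm{d}$ defined on the dense domain $V\subset W$. Suppose that $V_h\subset V$ is a family of closed subspaces (closed in $V$), parametrized by $h$, satisfying $\mathrm{d}V_h\subset V_h$. Suppose also that these subspaces are equipped with projections $\pi_h\colon V\to V_h$, bounded uniformly in $h$, such that $\pi_h\mathrm{d}=\mathrm{d}\pi_h$. Then there is a constant $C>0$, independent of $h$ and $f$, such that the following holds for every $f\in W$ and every $h$. If $(u,p)\in V\times\mathfrak{H}$ solves $$\langle \mathrm{d}u,v\rangle+\langle u,\mathrm{d}v\rangle+\langle p,v\rangle=\langle f,v\rangle\ \ \forall v\in V,\qquad \langle u,q\rangle=0\ \ \forall q\in\mathfrak{H},$$ and $(u_h,p_h)\in V_h\times\mathfrak{H}_h$ solves $$\langle \mathrm{d}u_h,v_h\rangle+\langle u_h,\mathrm{d}v_h\rangle+\langle p_h,v_h\rangle=\langle f,v_h\rangle\ \ \forall v_h\in V_h,\qquad \langle u_h,q_h\rangle=0\ \ \forall q_h\in\mathfrak{H}_h,$$ then $$\|u-u_h\|_V+\|p-p_h\|\le C\Bigl(\inf_{v\in V_h}\|u-v\|_V+\inf_{q\in V_h}\|p-q\|_V+\mu\inf_{v\in V_h}\|P_{\mathfrak{B}}u-v\|_V\Bigr),$$ where $\mu=\|(I-\pi_h)P_{\mathfrak{H}}\|$.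
   Context: $W$ has inner product $\langle\cdot,\cdot\rangle$ and norm $\|\cdot\|$. A closed, densely defined linear operator $\mathrm{d}$ on $W$ with domain $V=\mathcal{D}(\mathrm{d})$ is nilpotent if its range is contained in its kernel (so $\mathrm{d}^2=0$), and closed-nilpotent if in addition its range is closed. $V$ carries the graph inner product $\langle u,v\rangle_V=\langle u,v\rangle+\langle \mathrm{d}u,\mathrm{d}v\rangle$ with norm $\|\cdot\|_V$. Set $\mathfrak{Z}=\ker\mathrm{d}$, $\mathfrak{B}=\operatorname{range}\mathrm{d}$, $\mathfrak{H}=\mathfrak{Z}\cap\mathfrak{B}^{\perp_W}$, where $\perp_W$ is the orthogonal complement in $W$. $P_{\mathfrak{B}}$ and $P_{\mathfrak{H}}$ are the $W$-orthogonal projections onto $\mathfrak{B}$ and $\mathfrak{H}$. "Projection $\pi_h$" means linear, idempotent and surjective onto $V_h$ (not necessarily orthogonal); boundedness of $\pi_h$ is with respect to $\|\cdot\|_V$. The quantity $\mu$ (which depends on $h$) is the operator norm of $(I-\pi_h)P_{\mathfrak{H}}$ as an operator on $W$. For the restriction $\mathrm{d}_h=\mathrm{d}|_{V_h}$ put $\mathfrak{Z}_h=\ker\mathrm{d}_h$, $\mathfrak{B}_h=\mathrm{d}V_h$, and $\mathfrak{H}_h=\{z\in\mathfrak{Z}_h:\langle z,b\rangle=0\ \forall b\in\mathfrak{B}_h\}$. *)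

theory Defs
  imports "HOL-Analysis.Analysis"
begin

text \<open>
  An unbounded operator on \<open>W\<close> with domain \<open>V\<close> is a total function \<open>d\<close> together with the set
  \<open>V\<close>; the values of \<open>d\<close> off \<open>V\<close> are junk and never used. The restriction of \<open>d\<close> to a subspace
  \<open>X\<close> is the pair of \<open>X\<close> and \<open>d\<close>.
\<close>

definition linear_map_on :: "'a::real_vector set \<Rightarrow> ('a \<Rightarrow> 'b::real_vector) \<Rightarrow> bool" where
  "linear_map_on V T \<longleftrightarrow> subspace V \<and>
     (\<forall>x\<in>V. \<forall>y\<in>V. T (x + y) = T x + T y) \<and> (\<forall>c. \<forall>x\<in>V. T (c *\<^sub>R x) = c *\<^sub>R T x)"

definition closed_densely_defined :: "'a::real_normed_vector set \<Rightarrow> ('a \<Rightarrow> 'a) \<Rightarrow> bool" where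
  "closed_densely_defined V d \<longleftrightarrow>
     linear_map_on V d \<and> closure V = UNIV \<and> closed ((\<lambda>v. (v, d v)) ` V)"

definition ker_on :: "'a set \<Rightarrow> ('a \<Rightarrow> 'b::zero) \<Rightarrow> 'a set" where
  "ker_on X d = {v \<in> X. d v = 0}"

definition nilpotent_op :: "'a::real_normed_vector set \<Rightarrow> ('a \<Rightarrow> 'a) \<Rightarrow> bool" where
  "nilpotent_op V d \<longleftrightarrow> closed_densely_defined V d \<and> d ` V \<subseteq> ker_on V d"

definition closed_nilpotent_op :: "'a::real_normed_vector set \<Rightarrow> ('a \<Rightarrow> 'a) \<Rightarrow> bool" where
  "closed_nilpotent_op V d \<longleftrightarrow> nilpotent_op V d \<and> closed (d ` V)"

definition graph_inner :: "('a::real_inner \<Rightarrow> 'a) \<Rightarrow> 'a \<Rightarrow> 'a \<Rightarrow> real" where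
  "graph_inner d u v = u \<bullet> v + d u \<bullet> d v"

definition graph_norm :: "('a::real_inner \<Rightarrow> 'a) \<Rightarrow> 'a \<Rightarrow> real" where
  "graph_norm d v = sqrt (graph_inner d v v)"

text \<open>
  The value \<open>0\<close> off \<open>V\<close> is needed because \<^locale>\<open>Metric_space\<close> demands symmetry of the
  distance also outside the carrier.
\<close>

definition graph_dist :: "'a::real_inner set \<Rightarrow> ('a \<Rightarrow> 'a) \<Rightarrow> 'a \<Rightarrow> 'a \<Rightarrow> real" where
  "graph_dist V d u v = (if u \<in> V \<and> v \<in> V then graph_norm d (u - v) else 0)"

definition graph_topology :: "'a::real_inner set \<Rightarrow> ('a \<Rightarrow> 'a) \<Rightarrow> 'a topology" where
  "graph_topology V d = Metric_space.mtopology V (graph_dist V d)"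

text \<open>
  Used with \<open>X = V\<close> for the harmonic space and with \<open>X = V\<^sub>h\<close> for the discrete one; in both
  cases the complement is taken in \<open>W\<close> and the intersection with the kernel restricts it to \<open>X\<close>.
\<close>

definition harmonic :: "'a::real_inner set \<Rightarrow> ('a \<Rightarrow> 'a) \<Rightarrow> 'a set" where
  "harmonic X d = ker_on X d \<inter> (d ` X)\<^sup>\<bottom>"

text \<open>
  The \<open>W\<close>-orthogonal projection onto \<open>S\<close>. It exists when \<open>S\<close> is a closed subspace and the space
  is complete, which holds for both uses below.
\<close>

definition orth_proj :: "'a::real_inner set \<Rightarrow> 'a \<Rightarrow> 'a" where
  "orth_proj S w = (THE p. p \<in> S \<and> w - p \<in> S\<^sup>\<bottom>)"

definition projection_onto :: "'a::real_vector set \<Rightarrow> 'a set \<Rightarrow> ('a \<Rightarrow> 'a) \<Rightarrow> bool" where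
  "projection_onto V X P \<longleftrightarrow>
     linear_map_on V P \<and> P ` V = X \<and> (\<forall>v\<in>V. P (P v) = P v)"

text \<open>
  The quantity \<open>\<mu>\<close>, an operator norm on \<open>W\<close>: harmonic elements lie in \<open>V\<close>, so applying \<open>P\<close> to
  them makes sense.
\<close>

definition harmonic_gap :: "'a::real_inner set \<Rightarrow> ('a \<Rightarrow> 'a) \<Rightarrow> ('a \<Rightarrow> 'a) \<Rightarrow> real" where
  "harmonic_gap V d P =
     onorm (\<lambda>w. orth_proj (harmonic V d) w - P (orth_proj (harmonic V d) w))"

lemma linear_map_on_diff:
  assumes "linear_map_on V T" "x \<in> V" "y \<in> V"
  shows "T (x - y) = T x - T y"
proof -
  have V: "subspace V" and add: "\<And>x y. x \<in> V \<Longrightarrow> y \<in> V \<Longrightarrow> T (x + y) = T x + T y"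
    using assms(1) by (auto simp: linear_map_on_def)
  have "T x = T ((x - y) + y)" by simp
  also have "\<dots> = T (x - y) + T y"
    using V assms(2,3) by (intro add) (auto simp: subspace_diff)
  finally show ?thesis by simp
qed

lemma graph_norm_eq_norm_Pair: "graph_norm d v = norm (v, d v)"
  by (simp add: graph_norm_def graph_inner_def norm_Pair power2_norm_eq_inner)

lemma graph_dist_eq_dist_Pair:
  assumes "linear_map_on V d" "u \<in> V" "v \<in> V"
  shows "graph_dist V d u v = dist (u, d u) (v, d v)"
  using assms by (simp add: graph_dist_def graph_norm_eq_norm_Pair linear_map_on_diff dist_norm)

text \<open>Hence \<^const>\<open>graph_topology\<close> is the topology of the graph norm.\<close>

lemma Metric_space_graph_dist:
  assumes "linear_map_on V d"
  shows "Metric_space V (graph_dist V d)"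
proof
  show "0 \<le> graph_dist V d x y" for x y
    by (simp add: graph_dist_def graph_norm_eq_norm_Pair)
  show "graph_dist V d x y = graph_dist V d y x" for x y
    by (cases "x \<in> V \<and> y \<in> V")
      (auto simp: graph_dist_eq_dist_Pair[OF assms] dist_commute, auto simp: graph_dist_def)
  show "graph_dist V d x y = 0 \<longleftrightarrow> x = y" if "x \<in> V" "y \<in> V" for x y
    using that by (auto simp: graph_dist_eq_dist_Pair[OF assms])
  show "graph_dist V d x z \<le> graph_dist V d x y + graph_dist V d y z"
    if "x \<in> V" "y \<in> V" "z \<in> V" for x y z
    using that by (simp add: graph_dist_eq_dist_Pair[OF assms] dist_triangle)
qed

lemma orth_proj_eqI:
  assumes "subspace S" "p \<in> S" "w - p \<in> S\<^sup>\<bottom>"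
  shows "orth_proj S w = p"
  unfolding orth_proj_def
proof (rule the_equality)
  show "p \<in> S \<and> w - p \<in> S\<^sup>\<bottom>" using assms by simp
  fix q assume q: "q \<in> S \<and> w - q \<in> S\<^sup>\<bottom>"
  have "q - p \<in> S" using assms q by (simp add: subspace_diff)
  moreover have "(w - p) - (w - q) \<in> S\<^sup>\<bottom>"
    using assms q subspace_diff[OF subspace_orthogonal_comp] by blast
  ultimately have "(q - p) \<bullet> (q - p) = 0"
    by (auto simp: orthogonal_comp_def orthogonal_def)
  then show "q = p" by simp
qed

end

theory Submission
  imports Defs
begin

text \<open>
  By the open mapping theorem \<open>d\<close> has a bounded right inverse on its closed range (Poincare
  inequality), and the commuting projections transfer this inequality to \<open>V\<^sub>h\<close> with a constant
  independent of \<open>h\<close>. The Hodge decomposition of \<open>V\<^sub>h\<close> then makes the discrete problem uniformly stable.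
  The discretization is consistent except that \<open>u\<close> is orthogonal to \<open>\<HH>\<close> but not to \<open>\<HH>\<^sub>h\<close>.
  For \<open>q \<in> \<HH>\<^sub>h\<close> this defect is
  \<open>\<langle>u, q\<rangle> = \<langle>(I - \<pi>\<^sub>h) P\<^sub>\<BB> u, q - P\<^sub>\<HH> q\<rangle>\<close>, and
  \<open>\<parallel>q - P\<^sub>\<HH> q\<parallel> \<le> \<mu> \<parallel>q\<parallel>\<close>, which gives the third term of the bound.
\<close>

subsection \<open>The open mapping theorem for closed range\<close>

text \<open>Telescoping against a geometric series. The second bound survives the passage to the
  limit and controls the norm of the preimage that the open mapping theorem builds by
  iteration.\<close>

lemma geometric_steps_Cauchy:
  fixes s :: "nat \<Rightarrow> 'a::real_normed_vector"
  assumes step: "\<And>n. norm (s (Suc n) - s n) \<le> K * (1/2) ^ n"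
  shows "Cauchy s" and "norm (s n - s 0) \<le> 2 * K"
proof -
  \<comment> \<open>The subtracted power keeps the exact partial geometric sum, so the induction on
    \<open>j\<close> closes; the weaker bound \<open>tail\<close> would not reproduce
    itself.\<close>
  have diff: "norm (s (n + j) - s n) \<le> 2 * K * ((1/2) ^ n - (1/2) ^ (n + j))" for n j
  proof (induction j)
    case (Suc j)
    have "norm (s (n + Suc j) - s n) \<le> norm (s (Suc (n + j)) - s (n + j)) + norm (s (n + j) - s n)"
      using norm_triangle_ineq[of "s (Suc (n + j)) - s (n + j)" "s (n + j) - s n"] by simp
    also have "\<dots> \<le> K * (1/2) ^ (n + j) + 2 * K * ((1/2) ^ n - (1/2) ^ (n + j))"
      using step[of "n + j"] Suc by linarith
    finally show ?case by (simp add: field_simps)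
  qed simp
  have "0 \<le> K" using order_trans[OF norm_ge_zero step[of 0]] by simp
  have tail: "norm (s (n + j) - s n) \<le> 2 * K * (1/2) ^ n" for n j
    by (rule order_trans[OF diff]) (use \<open>0 \<le> K\<close> in \<open>simp add: right_diff_distrib\<close>)
  show "norm (s n - s 0) \<le> 2 * K" using tail[of 0 n] by simp
  show "Cauchy s"
  proof (rule CauchyI')
    fix e :: real assume "0 < e"
    have "(\<lambda>n. 2 * K * (1/2) ^ n) \<longlonglongrightarrow> 2 * K * 0"
      by (intro tendsto_intros) auto
    then obtain N where N: "2 * K * (1/2) ^ n < e" if "n \<ge> N" for n
      using order_tendstoD(2)[of _ _ sequentially e] \<open>0 < e\<close> unfolding eventually_sequentially by force
    have "norm (s m - s n) < e" if "N \<le> m" "m < n" for m n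
    proof -
      have "norm (s (m + (n - m)) - s m) < e"
        using tail[of m "n - m"] N[of m] that by linarith
      then show ?thesis using that by (simp add: norm_minus_commute)
    qed
    then show "\<exists>M. \<forall>m\<ge>M. \<forall>n>m. dist (s m) (s n) < e" unfolding dist_norm by blast
  qed
qed

text \<open>Banach's argument, with Baire's theorem applied to the range as a complete space. The
  intended use is \<open>snd\<close> on the graph of \<open>d\<close>, which replaces an unbounded
  operator by a bounded one.\<close>

lemma open_mapping_closed_range:
  fixes T :: "'a::{real_normed_vector,complete_space} \<Rightarrow> 'b::{real_normed_vector,complete_space}"
  assumes T: "bounded_linear T" and S: "subspace S" "closed S" and closed_range: "closed (T ` S)"
  obtains c where "\<And>y. y \<in> T ` S \<Longrightarrow> \<exists>x\<in>S. T x = y \<and> norm x \<le> c * norm y"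
proof -
  interpret T: bounded_linear T by fact
  define B where "B = T ` S"
  have B: "subspace B"
    unfolding B_def by (rule linear_subspace_image[OF T.linear S(1)])
  define A where "A n = closure (T ` (S \<inter> cball 0 (real n)))" for n
  have A_sub: "A n \<subseteq> B" for n
    unfolding A_def using closed_range by (intro closure_minimal) (auto simp: B_def)
  have A_minus: "- y \<in> A n" if "y \<in> A n" for y n
  proof -
    let ?X = "T ` (S \<inter> cball 0 (real n))"
    have "uminus ` ?X \<subseteq> ?X"
      using S(1) by (auto simp: subspace_neg T.neg[symmetric] intro!: imageI)
    then have "uminus ` closure ?X \<subseteq> closure ?X"
      by (intro order_trans[OF closure_bounded_linear_image_subset] closure_mono
          bounded_linear_minus bounded_linear_ident)
    then show ?thesis using that unfolding A_def by blast
  qed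
  have A_convex: "convex (A n)" for n
    unfolding A_def
    by (intro convex_closure convex_linear_image T.linear convex_Int subspace_imp_convex S convex_cball)
  have "\<exists>n. (top_of_set B) interior_of (A n) \<noteq> {}"
  proof (rule ccontr)
    assume "\<nexists>n. top_of_set B interior_of A n \<noteq> {}"
    have "top_of_set B interior_of \<Union>(range A) = {}"
    proof (intro Baire_category_alt disjI1)
      show "completely_metrizable_space (top_of_set B)"
        using closed_range unfolding B_def
        by (intro completely_metrizable_space_closedin completely_metrizable_space_euclidean) simp
      show "closedin (top_of_set B) X \<and> top_of_set B interior_of X = {}" if "X \<in> range A" for X
        using that \<open>\<nexists>n. top_of_set B interior_of A n \<noteq> {}\<close> A_sub
        by (auto simp: A_def intro!: closed_subset)
    qed simp
    moreover have "B = \<Union>(range A)"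
    proof
      show "B \<subseteq> \<Union>(range A)"
      proof
        fix y assume "y \<in> B"
        then obtain x where x: "x \<in> S" "y = T x" by (auto simp: B_def)
        obtain n where "norm x \<le> real n" using real_arch_simple by blast
        then have "y \<in> T ` (S \<inter> cball 0 (real n))" using x by auto
        then have "y \<in> A n" unfolding A_def by (rule subsetD[OF closure_subset])
        then show "y \<in> \<Union>(range A)" by (rule UN_I[OF UNIV_I])
      qed
    qed (use A_sub in auto)
    moreover have "top_of_set B interior_of B = B"
      using interior_of_topspace[of "top_of_set B"] by simp
    ultimately show False using subspace_0[OF B] by simp
  qed
  then obtain n y0 where "y0 \<in> (top_of_set B) interior_of (A n)" by blast
  then obtain r where r: "r > 0" "y0 \<in> B" "B \<inter> cball y0 r \<subseteq> A n"
  proof -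
    obtain U where "openin (top_of_set B) U" "y0 \<in> U" "U \<subseteq> A n"
      using \<open>y0 \<in> _\<close> by (auto simp: interior_of_def)
    then obtain r where "r > 0" "cball y0 r \<inter> B \<subseteq> U" "U \<subseteq> B"
      unfolding openin_contains_cball by blast
    with \<open>y0 \<in> U\<close> \<open>U \<subseteq> A n\<close> show thesis by (intro that[of r]) auto
  qed
  have small: "y \<in> A n" if "y \<in> B" "norm y \<le> r" for y
  proof -
    \<comment> \<open>\<open>y\<close> is the midpoint of \<open>y0 + y\<close> and
      \<open>- (y0 - y)\<close>, so symmetry and convexity of \<open>A n\<close> move the ball from
      \<open>y0\<close> to the origin.\<close>
    have "y0 + y \<in> A n" "y0 - y \<in> A n"
      using r that B by (auto simp: dist_norm subspace_add subspace_diff intro!: subsetD[OF r(3)])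
    then have "(1/2) *\<^sub>R (y0 + y) + (1/2) *\<^sub>R (- (y0 - y)) \<in> A n"
      by (intro convexD[OF A_convex] A_minus) auto
    then show ?thesis
      by (simp add: scaleR_right_distrib scaleR_right_diff_distrib scaleR_left_distrib[symmetric])
  qed
  \<comment> \<open>The ball of radius \<open>r\<close> is approximated by images of elements of
    norm at most \<open>n\<close>, so the ratio is the cost of a preimage per unit of norm.\<close>
  define c where "c = real n / r"
  have approx: "\<exists>x\<in>S. norm x \<le> c * norm y \<and> norm (y - T x) \<le> norm y / 2" if y: "y \<in> B" for y
  proof (cases "y = 0")
    case True
    then show ?thesis using S(1) by (intro bexI[of _ 0]) (auto simp: subspace_0 T.zero)
  next
    case False
    \<comment> \<open>Rescaling puts \<open>y\<close> on the sphere of radius \<open>r\<close>; the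
      tolerance \<open>r / 2\<close> becomes \<open>norm y / 2\<close> after scaling back.\<close>
    define t where "t = r / norm y"
    have t: "t > 0" using False r by (simp add: t_def)
    have "t *\<^sub>R y \<in> A n"
      using y B False r by (intro small) (auto simp: subspace_scale t_def)
    then obtain y' where y': "y' \<in> T ` (S \<inter> cball 0 (real n))" "dist y' (t *\<^sub>R y) < r / 2"
      unfolding A_def closure_approachable using r half_gt_zero by blast
    then obtain x where x: "x \<in> S" "norm x \<le> real n" "dist (T x) (t *\<^sub>R y) < r / 2" by auto
    have eq: "y - T ((1/t) *\<^sub>R x) = (1/t) *\<^sub>R (t *\<^sub>R y - T x)"
      using t by (simp add: T.scaleR scaleR_right_diff_distrib)
    have "norm (y - T ((1/t) *\<^sub>R x)) \<le> (1/t) * (r / 2)"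
    proof -
      have "norm (t *\<^sub>R y - T x) \<le> r / 2"
        using x(3) by (simp add: dist_norm norm_minus_commute)
      then have "(1/t) * norm (t *\<^sub>R y - T x) \<le> (1/t) * (r / 2)"
        using t by (intro mult_left_mono) auto
      then show ?thesis unfolding eq norm_scaleR using t by simp
    qed
    also have "\<dots> = norm y / 2" using r False by (simp add: t_def)
    finally have "norm (y - T ((1/t) *\<^sub>R x)) \<le> norm y / 2" .
    moreover have "norm ((1/t) *\<^sub>R x) \<le> c * norm y"
      using x(2) r False by (simp add: t_def c_def divide_simps mult.commute mult_left_mono)
    ultimately show ?thesis
      using x(1) S(1) by (intro bexI[of _ "(1/t) *\<^sub>R x"]) (auto simp: subspace_scale)
  qed
  then obtain g where g: "g y \<in> S" "norm (g y) \<le> c * norm y" "norm (y - T (g y)) \<le> norm y / 2"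
    if "y \<in> B" for y
    by metis
  have "\<exists>x\<in>S. T x = y \<and> norm x \<le> (2 * c) * norm y" if y: "y \<in> B" for y
  proof -
    \<comment> \<open>Successive correction: each step adds an approximate preimage of the current
      residual. The residuals halve, and the increments sum to at most
      \<open>2 * c * norm y\<close>.\<close>
    define s where "s = rec_nat 0 (\<lambda>_ x. x + g (y - T x))"
    have s0: "s 0 = 0" and sSuc: "s (Suc k) = s k + g (y - T (s k))" for k
      by (simp_all add: s_def)
    have T_B: "T x \<in> B" if "x \<in> S" for x using that by (simp add: B_def)
    have s: "s k \<in> S \<and> norm (y - T (s k)) \<le> norm y * (1/2) ^ k" for k
    proof (induction k)
      case 0
      then show ?case using S(1) by (simp add: s0 subspace_0 T.zero)
    next
      case (Suc k)
      then have *: "y - T (s k) \<in> B" using y B T_B by (simp add: subspace_diff)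
      have "s (Suc k) \<in> S" using g(1)[OF *] Suc S(1) by (simp add: sSuc subspace_add)
      moreover have "y - T (s (Suc k)) = (y - T (s k)) - T (g (y - T (s k)))"
        by (simp add: sSuc T.add)
      then have "norm (y - T (s (Suc k))) \<le> norm (y - T (s k)) / 2" using g(3)[OF *] by (simp only:)
      ultimately show ?case using Suc by simp
    qed
    have c0: "c \<ge> 0" using r by (simp add: c_def)
    have step: "norm (s (Suc k) - s k) \<le> (c * norm y) * (1/2) ^ k" for k
    proof -
      have "y - T (s k) \<in> B" using y B T_B s by (simp add: subspace_diff)
      then have "norm (s (Suc k) - s k) \<le> c * norm (y - T (s k))"
        using g by (simp add: sSuc)
      also have "\<dots> \<le> c * (norm y * (1/2) ^ k)" using s c0 by (intro mult_left_mono) auto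
      finally show ?thesis by (simp add: mult.assoc)
    qed
    obtain x where x: "s \<longlonglongrightarrow> x"
      using geometric_steps_Cauchy(1)[of s, OF step] Cauchy_convergent_iff convergent_def by blast
    have "x \<in> S" using closed_sequentially[OF S(2) _ x] s by blast
    moreover have "norm x \<le> 2 * (c * norm y)"
      using geometric_steps_Cauchy(2)[of s, OF step] s0
      by (intro Lim_bounded[OF tendsto_norm[OF x], of 0]) auto
    moreover have "T x = y"
    proof -
      have "(\<lambda>k. y - T (s k)) \<longlonglongrightarrow> 0"
      proof (rule Lim_null_comparison)
        show "\<forall>\<^sub>F k in sequentially. norm (y - T (s k)) \<le> norm y * (1/2) ^ k" using s by simp
        show "(\<lambda>k. norm y * (1/2) ^ k) \<longlonglongrightarrow> 0"
          by (intro tendsto_mult_right_zero LIMSEQ_power_zero) simp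
      qed
      moreover have "(\<lambda>k. y - T (s k)) \<longlonglongrightarrow> y - T x"
        by (intro tendsto_intros T.tendsto x)
      ultimately show ?thesis using LIMSEQ_unique by fastforce
    qed
    ultimately show ?thesis by (auto simp: mult.assoc)
  qed
  then show ?thesis using that unfolding B_def by blast
qed

subsection \<open>Orthogonal projections in Hilbert spaces\<close>

text \<open>Cancels a factor that may be zero, after an identity has been tested with the quantity
  to be bounded.\<close>

lemma norm_le_of_power2_le_mult:
  assumes "(norm x)\<^sup>2 \<le> b * norm x" "0 \<le> b"
  shows "norm x \<le> b"
  using assms by (cases "x = 0") (auto simp: power2_eq_square)

text \<open>A minimizing sequence for the distance to \<open>S\<close> is Cauchy by the
  parallelogram law, and minimality of its limit forces orthogonality.\<close>

lemma orth_proj_exists: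
  fixes S :: "'a::{real_inner,complete_space} set"
  assumes S: "subspace S" "closed S"
  shows "\<exists>p\<in>S. w - p \<in> S\<^sup>\<bottom>"
proof -
  define \<delta> where "\<delta> = (INF x\<in>S. (norm (w - x))\<^sup>2)"
  have ne: "S \<noteq> {}" using subspace_0[OF S(1)] by blast
  have bdd: "bdd_below ((\<lambda>x. (norm (w - x))\<^sup>2) ` S)" by (rule bdd_belowI[of _ 0]) auto
  have \<delta>_le: "\<delta> \<le> (norm (w - x))\<^sup>2" if "x \<in> S" for x
    unfolding \<delta>_def using bdd that by (rule cINF_lower)
  have near: "\<exists>x\<in>S. (norm (w - x))\<^sup>2 < \<delta> + 1 / real (Suc n)" for n
    using cINF_less_iff[OF ne bdd, of "\<delta> + 1 / real (Suc n)"] by (simp add: \<delta>_def)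
  then obtain x where x: "x n \<in> S" "(norm (w - x n))\<^sup>2 < \<delta> + 1 / real (Suc n)" for n
    by metis
  have close: "(norm (x m - x n))\<^sup>2 \<le> 2 * (1 / real (Suc m) + 1 / real (Suc n))" for m n
  proof -
    have "(1/2) *\<^sub>R (x m + x n) \<in> S" using x S(1) by (simp add: subspace_add subspace_scale)
    note mid = \<delta>_le[OF this]
    \<comment> \<open>Parallelogram law for \<open>w - x m\<close> and \<open>w - x n\<close>. The
      midpoint lies in \<open>S\<close>, so the first term is at least \<open>4 * \<delta>\<close>,
      and only the two tolerances remain.\<close>
    have "4 * (norm (w - (1/2) *\<^sub>R (x m + x n)))\<^sup>2 + (norm (x m - x n))\<^sup>2
        = 2 * (norm (w - x m))\<^sup>2 + 2 * (norm (w - x n))\<^sup>2"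
      unfolding power2_norm_eq_inner by (simp add: algebra_simps inner_commute)
    then show ?thesis using mid x(2)[of m] x(2)[of n] by argo
  qed
  have "Cauchy x"
  proof (rule CauchyI')
    fix e :: real assume "0 < e"
    obtain N where N: "4 / e\<^sup>2 < real N" using reals_Archimedean2 by blast
    have "norm (x m - x n) < e" if "N \<le> m" "m < n" for m n
    proof -
      have "1 / real (Suc m) \<le> 1 / real (Suc N)" "1 / real (Suc n) \<le> 1 / real (Suc N)"
        using that by (auto simp: frac_le)
      then have "(norm (x m - x n))\<^sup>2 \<le> 4 * (1 / real (Suc N))" using close[of m n] by argo
      also have "\<dots> < e\<^sup>2" 
      proof -
        have "4 < real (Suc N) * e\<^sup>2"
          using N \<open>0 < e\<close> by (simp add: pos_divide_less_eq distrib_right add_strict_increasing)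
        then show ?thesis by (simp add: pos_divide_less_eq mult.commute)
      qed
      finally show ?thesis by (rule power2_less_imp_less) (use \<open>0 < e\<close> in simp)
    qed
    then show "\<exists>M. \<forall>m\<ge>M. \<forall>n>m. dist (x m) (x n) < e" unfolding dist_norm by blast
  qed
  then obtain p where p: "x \<longlonglongrightarrow> p"
    using Cauchy_convergent_iff convergent_def by blast
  have pS: "p \<in> S" using closed_sequentially[OF S(2) _ p] x by blast
  have "(\<lambda>n. \<delta> + 1 / real (Suc n)) \<longlonglongrightarrow> \<delta> + 0"
    using LIMSEQ_inverse_real_of_nat by (intro tendsto_intros) (simp add: inverse_eq_divide)
  moreover have "(\<lambda>n. (norm (w - x n))\<^sup>2) \<longlonglongrightarrow> (norm (w - p))\<^sup>2"
    by (intro tendsto_intros p)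
  ultimately have min: "(norm (w - p))\<^sup>2 \<le> \<delta>"
    using x(2) by (intro LIMSEQ_le[of "\<lambda>n. (norm (w - x n))\<^sup>2" _ "\<lambda>n. \<delta> + 1 / real (Suc n)"]) (auto intro: less_imp_le)
  have "y \<bullet> (w - p) = 0" if y: "y \<in> S" for y
  proof (cases "y = 0")
    case False
    \<comment> \<open>The minimizer of the squared distance along the line through \<open>p\<close>
      in direction \<open>y\<close>.\<close>
    define t where "t = (y \<bullet> (w - p)) / (y \<bullet> y)"
    have "p + t *\<^sub>R y \<in> S" using pS y S(1) by (simp add: subspace_add subspace_scale)
    then have "(norm (w - p))\<^sup>2 \<le> (norm (w - (p + t *\<^sub>R y)))\<^sup>2"
      by (rule order_trans[OF min \<delta>_le])
    also have "\<dots> = (norm (w - p))\<^sup>2 - 2 * t * (y \<bullet> (w - p)) + t\<^sup>2 * (y \<bullet> y)"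
      unfolding power2_norm_eq_inner by (simp add: algebra_simps inner_commute power2_eq_square)
    also have "\<dots> = (norm (w - p))\<^sup>2 - (y \<bullet> (w - p))\<^sup>2 / (y \<bullet> y)"
      using False by (simp add: t_def power2_eq_square)
    finally have "(y \<bullet> (w - p))\<^sup>2 / (y \<bullet> y) \<le> 0" by simp
    moreover have "y \<bullet> y > 0" using False by simp
    ultimately show ?thesis by (simp add: divide_le_0_iff)
  qed simp
  then show ?thesis using pS by (auto simp: orthogonal_comp_def orthogonal_def)
qed

lemma closed_orthogonal_comp: "closed (A\<^sup>\<bottom>)" for A :: "'a::real_inner set"
proof -
  have "A\<^sup>\<bottom> = (\<Inter>y\<in>A. {x. y \<bullet> x = 0})"
    by (auto simp: orthogonal_comp_def orthogonal_def)
  then show ?thesis by (auto intro!: closed_INT closed_Collect_eq continuous_intros)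
qed

context
  fixes S :: "'a::{real_inner,complete_space} set"
  assumes S: "subspace S" "closed S"
begin

lemma orth_proj_in: "orth_proj S w \<in> S"
  and orth_proj_orthogonal: "x \<in> S \<Longrightarrow> (w - orth_proj S w) \<bullet> x = 0"
proof -
  obtain p where p: "p \<in> S" "w - p \<in> S\<^sup>\<bottom>" using orth_proj_exists[OF S] by blast
  then have "orth_proj S w = p" by (intro orth_proj_eqI S)
  with p show "orth_proj S w \<in> S" "x \<in> S \<Longrightarrow> (w - orth_proj S w) \<bullet> x = 0"
    by (auto simp: orthogonal_comp_def orthogonal_def inner_commute)
qed

lemma inner_orth_proj: "x \<in> S \<Longrightarrow> orth_proj S w \<bullet> x = w \<bullet> x"
  using orth_proj_orthogonal[of x w] by (simp add: inner_diff_left)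

lemma orth_proj_unique:
  assumes "p \<in> S" "\<And>x. x \<in> S \<Longrightarrow> (w - p) \<bullet> x = 0"
  shows "orth_proj S w = p"
  using assms by (intro orth_proj_eqI S) (auto simp: orthogonal_comp_def orthogonal_def inner_commute)

lemma linear_orth_proj: "linear (orth_proj S)"
proof (rule linearI)
  show "orth_proj S (v + w) = orth_proj S v + orth_proj S w" for v w
    using S(1) orth_proj_in
    by (intro orth_proj_unique) (auto simp: subspace_add inner_add_left inner_diff_left inner_orth_proj)
  show "orth_proj S (c *\<^sub>R w) = c *\<^sub>R orth_proj S w" for c w
    using S(1) orth_proj_in
    by (intro orth_proj_unique) (auto simp: subspace_scale inner_diff_left inner_orth_proj)
qed

lemma norm_orth_proj_le: "norm (orth_proj S w) \<le> norm w"
proof -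
  have "(norm (orth_proj S w))\<^sup>2 = w \<bullet> orth_proj S w"
    by (simp add: power2_norm_eq_inner inner_orth_proj orth_proj_in)
  also have "\<dots> \<le> norm w * norm (orth_proj S w)" by (rule norm_cauchy_schwarz)
  finally show ?thesis by (rule norm_le_of_power2_le_mult) simp
qed

end

lemma norm_diff_orth_proj_le:
  fixes S :: "'a::{real_inner,complete_space} set"
  assumes S: "subspace S" "closed S" and x: "x \<in> S"
  shows "norm (w - orth_proj S w) \<le> norm (w - x)"
proof -
  let ?e = "w - orth_proj S w"
  have "?e \<bullet> (orth_proj S w - x) = 0"
    using S x by (intro orth_proj_orthogonal) (auto simp: subspace_diff orth_proj_in)
  then have "(norm ?e)\<^sup>2 = ?e \<bullet> (w - x)"
    by (simp add: power2_norm_eq_inner inner_diff_right)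
  also have "\<dots> \<le> norm ?e * norm (w - x)" by (rule norm_cauchy_schwarz)
  also have "\<dots> = norm (w - x) * norm ?e" by (rule mult.commute)
  finally show ?thesis by (rule norm_le_of_power2_le_mult) simp
qed

subsection \<open>Closed-nilpotent operators\<close>

text \<open>Lets the infima of the final estimate be taken one variable at a time, the other terms
  being kept in \<open>b\<close>. The factor \<open>K\<close> can vanish when the harmonic gap is
  zero, hence the case split before dividing.\<close>

lemma le_mult_cINF:
  fixes g :: "'a \<Rightarrow> real"
  assumes "S \<noteq> {}" "0 \<le> K" "\<And>x. x \<in> S \<Longrightarrow> 0 \<le> g x" "\<And>x. x \<in> S \<Longrightarrow> a \<le> b + K * g x"
  shows "a \<le> b + K * (INF x\<in>S. g x)"
proof (cases "K = 0")
  case True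
  then show ?thesis using assms(1,4) by auto
next
  case False
  then have "(a - b) / K \<le> (INF x\<in>S. g x)"
    using assms by (intro cINF_greatest) (auto simp: field_simps)
  then show ?thesis using False assms(2) by (simp add: field_simps)
qed

lemma norm_le_graph_norm: "norm v \<le> graph_norm d v"
  and norm_op_le_graph_norm: "norm (d v) \<le> graph_norm d v"
  and graph_norm_le_add: "graph_norm d v \<le> norm v + norm (d v)"
  and graph_norm_nonneg: "0 \<le> graph_norm d v"
  by (simp_all add: graph_norm_eq_norm_Pair norm_fst_le norm_snd_le norm_Pair sqrt_sum_squares_le_sum)

locale closed_nilpotent =
  fixes V :: "'w::{real_inner,complete_space} set" and d :: "'w \<Rightarrow> 'w"
  assumes op: "closed_nilpotent_op V d"
begin

lemma lin: "linear_map_on V d"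
  and closed_graph: "closed ((\<lambda>v. (v, d v)) ` V)"
  and closed_range: "closed (d ` V)"
  using op by (auto simp: closed_nilpotent_op_def nilpotent_op_def closed_densely_defined_def)

lemma subspace_V: "subspace V"
  and d_add: "x \<in> V \<Longrightarrow> y \<in> V \<Longrightarrow> d (x + y) = d x + d y"
  and d_scale: "x \<in> V \<Longrightarrow> d (a *\<^sub>R x) = a *\<^sub>R d x"
  using lin by (auto simp: linear_map_on_def)

lemmas d_diff = linear_map_on_diff[OF lin]

lemma d_zero [simp]: "d 0 = 0"
  using d_scale[of 0 0] subspace_0[OF subspace_V] by simp

lemma d_in [simp, intro]: "v \<in> V \<Longrightarrow> d v \<in> V"
  and d_d [simp]: "v \<in> V \<Longrightarrow> d (d v) = 0"
  using op by (auto simp: closed_nilpotent_op_def nilpotent_op_def ker_on_def)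

lemma subspace_ker_on:
  assumes "subspace X" "X \<subseteq> V"
  shows "subspace (ker_on X d)"
  using assms d_add d_scale
  by (auto simp: subspace_def ker_on_def subset_eq)

lemma subspace_range:
  assumes "subspace X" "X \<subseteq> V"
  shows "subspace (d ` X)"
proof (rule subspaceI)
  show "0 \<in> d ` X" using subspace_0[OF assms(1)] d_zero by force
  show "x + y \<in> d ` X" if xy: "x \<in> d ` X" "y \<in> d ` X" for x y
  proof -
    obtain v w where "v \<in> X" "w \<in> X" "x = d v" "y = d w" using xy by blast
    then show ?thesis
      using assms by (intro image_eqI[of _ _ "v + w"]) (auto simp: d_add subset_eq subspace_add)
  qed
  show "a *\<^sub>R x \<in> d ` X" if x: "x \<in> d ` X" for a x
  proof -
    obtain v where "v \<in> X" "x = d v" using x by blast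
    then show ?thesis
      using assms by (intro image_eqI[of _ _ "a *\<^sub>R v"]) (auto simp: d_scale subset_eq subspace_scale)
  qed
qed

lemma subspace_harmonic:
  assumes "subspace X" "X \<subseteq> V"
  shows "subspace (harmonic X d)"
  unfolding harmonic_def by (intro subspace_inter subspace_ker_on subspace_orthogonal_comp assms)

text \<open>The kernel is the slice of the closed graph at second component 0.\<close>

lemma closed_kernel: "closed (ker_on V d)"
proof -
  have "ker_on V d = (\<lambda>v. (v, 0)) -` ((\<lambda>v. (v, d v)) ` V)"
    by (auto simp: ker_on_def)
  then show ?thesis
    by (auto intro!: closed_vimage closed_graph continuous_intros)
qed

lemma closed_harmonic: "closed (harmonic V d)"
  unfolding harmonic_def by (intro closed_Int closed_kernel closed_orthogonal_comp)

lemma harmonicD: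
  assumes "q \<in> harmonic X d"
  shows "q \<in> X" "d q = 0" "v \<in> X \<Longrightarrow> q \<bullet> d v = 0" "v \<in> X \<Longrightarrow> d v \<bullet> q = 0"
  using assms by (auto simp: harmonic_def ker_on_def orthogonal_comp_def orthogonal_def inner_commute)

section \<open>Hodge decomposition of the kernel and the Poincare inequality\<close>

lemmas range_V_closed = subspace_range[OF subspace_V order_refl] closed_range
lemmas harmonic_V = subspace_harmonic[OF subspace_V order_refl] closed_harmonic

lemma diff_orth_proj_range_harmonic:
  assumes "q \<in> V" "d q = 0"
  shows "q - orth_proj (d ` V) q \<in> harmonic V d"
proof -
  let ?b = "orth_proj (d ` V) q"
  have "?b \<in> d ` V" by (rule orth_proj_in[OF range_V_closed])
  then have b: "?b \<in> V" "d ?b = 0" by auto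
  have "d v \<bullet> (q - ?b) = 0" if "v \<in> V" for v
    using orth_proj_orthogonal[OF range_V_closed imageI[OF that], of q] by (simp only: inner_commute)
  then show ?thesis
    using assms b subspace_V
    by (auto simp: harmonic_def ker_on_def orthogonal_comp_def orthogonal_def d_diff subspace_diff)
qed

text \<open>Harmonic elements are orthogonal to the range, so the range part drops out. This is
  applied to discrete harmonic elements, which lie in the kernel but need not be orthogonal to the
  whole range.\<close>

lemma orth_proj_harmonic:
  assumes "q \<in> V" "d q = 0"
  shows "orth_proj (harmonic V d) q = q - orth_proj (d ` V) q"
proof (rule orth_proj_unique[OF harmonic_V])
  fix x assume "x \<in> harmonic V d"
  then show "(q - (q - orth_proj (d ` V) q)) \<bullet> x = 0"
    using orth_proj_in[OF range_V_closed, of q] by (auto dest: harmonicD)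
qed (rule diff_orth_proj_range_harmonic[OF assms])

text \<open>The graph of \<open>d\<close> is a closed subspace of the complete product space, the
  product norm on it is the graph norm, and \<open>snd\<close> maps it onto the closed range of
  \<open>d\<close>.\<close>

lemma poincare:
  obtains c where "0 \<le> c" "\<And>v. v \<in> V \<Longrightarrow> \<exists>z\<in>V. d z = d v \<and> graph_norm d z \<le> c * norm (d v)"
proof -
  define G where "G = (\<lambda>v. (v, d v)) ` V"
  have range: "snd ` G = d ` V" by (force simp: G_def)
  have "subspace G"
  proof (rule subspaceI)
    show "0 \<in> G" using subspace_0[OF subspace_V] by (auto simp: G_def zero_prod_def)
    show "x + y \<in> G" if "x \<in> G" "y \<in> G" for x y
      using that subspace_V d_add by (auto simp: G_def subspace_add intro!: image_eqI)
    show "a *\<^sub>R x \<in> G" if "x \<in> G" for a x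
      using that subspace_V d_scale by (auto simp: G_def subspace_scale intro!: image_eqI)
  qed
  moreover have "closed G" "closed (snd ` G)"
    using closed_graph closed_range range by (simp_all add: G_def)
  ultimately obtain c where c: "\<And>y. y \<in> snd ` G \<Longrightarrow> \<exists>x\<in>G. snd x = y \<and> norm x \<le> c * norm y"
    by (rule open_mapping_closed_range[OF bounded_linear_snd]) blast
  \<comment> \<open>The open mapping constant comes without a sign; the absolute value makes it
    nonnegative.\<close>
  have "\<exists>z\<in>V. d z = d v \<and> graph_norm d z \<le> \<bar>c\<bar> * norm (d v)" if "v \<in> V" for v
  proof -
    have "d v \<in> snd ` G" using that by (simp add: range)
    from c[OF this] obtain z where "z \<in> V" "d z = d v" "norm (z, d z) \<le> c * norm (d v)"
      by (auto simp: G_def)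
    moreover have "c * norm (d v) \<le> \<bar>c\<bar> * norm (d v)" by (intro mult_right_mono) auto
    ultimately show ?thesis unfolding graph_norm_eq_norm_Pair by (intro bexI[of _ z]) auto
  qed
  then show thesis by (intro that[of "\<bar>c\<bar>"]) auto
qed

end

subsection \<open>Subcomplexes with a bounded commuting projection\<close>

text \<open>A single member of the family, with the uniform bound \<open>M\<close> as a parameter:
  estimates in terms of \<open>M\<close> and the Poincare constant are then uniform over the
  family.\<close>

locale stable_subcomplex = closed_nilpotent V d
  for V :: "'w::{real_inner,complete_space} set" and d +
  fixes X :: "'w set" and \<pi> :: "'w \<Rightarrow> 'w" and M :: real
  assumes subspace_X: "subspace X"
    and X_sub: "X \<subseteq> V"
    and closed_X: "closedin (graph_topology V d) X"
    and d_X: "d ` X \<subseteq> X"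
    and proj: "projection_onto V X \<pi>"
    and M_nonneg: "0 \<le> M"
    and bounded: "v \<in> V \<Longrightarrow> graph_norm d (\<pi> v) \<le> M * graph_norm d v"
    and commute: "v \<in> V \<Longrightarrow> \<pi> (d v) = d (\<pi> v)"
begin

section \<open>Projection errors and closedness of the discrete kernel and range\<close>

lemma X_V [simp, intro]: "x \<in> X \<Longrightarrow> x \<in> V"
  and d_in_X [simp, intro]: "x \<in> X \<Longrightarrow> d x \<in> X"
  using X_sub d_X by auto

lemma \<pi>_lin: "linear_map_on V \<pi>"
  and \<pi>_in [simp, intro]: "v \<in> V \<Longrightarrow> \<pi> v \<in> X"
  using proj by (auto simp: projection_onto_def)

lemmas \<pi>_diff = linear_map_on_diff[OF \<pi>_lin]

lemma \<pi>_fix: "x \<in> X \<Longrightarrow> \<pi> x = x"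
  using proj by (auto simp: projection_onto_def)

text \<open>The projection fixes \<open>x\<close>, so \<open>v\<close> may be replaced by
  \<open>v - x\<close> in the error before the bound on \<open>\<pi>\<close> is used.\<close>

lemma graph_norm_diff_\<pi>_le:
  assumes v: "v \<in> V" and x: "x \<in> X"
  shows "graph_norm d (v - \<pi> v) \<le> (1 + M) * graph_norm d (v - x)"
proof -
  have V: "v - x \<in> V" "\<pi> (v - x) \<in> V"
    using v x subspace_V by (auto simp: subspace_diff)
  have eq: "v - \<pi> v = (v - x) - \<pi> (v - x)"
    using v x by (simp add: \<pi>_diff X_V \<pi>_fix)
  have "graph_norm d (v - \<pi> v) = norm ((v - x, d (v - x)) - (\<pi> (v - x), d (\<pi> (v - x))))"
    by (simp only: eq graph_norm_eq_norm_Pair diff_Pair d_diff[OF V])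
  also have "\<dots> \<le> graph_norm d (v - x) + graph_norm d (\<pi> (v - x))"
    unfolding graph_norm_eq_norm_Pair by (rule norm_triangle_ineq4)
  also have "\<dots> \<le> (1 + M) * graph_norm d (v - x)"
    using bounded[OF V(1)] by (simp add: distrib_right)
  finally show ?thesis .
qed

lemma norm_diff_\<pi>_le:
  assumes "v \<in> V" "x \<in> X"
  shows "norm (v - \<pi> v) \<le> (1 + M) * graph_norm d (v - x)"
  using order_trans[OF norm_le_graph_norm graph_norm_diff_\<pi>_le[OF assms]] .

text \<open>On the kernel the graph distance equals the distance of the ambient space, so closedness
  in the graph topology transfers.\<close>

lemma closed_ker_X: "closed (ker_on X d)"
  unfolding closed_sequential_limits
proof (intro allI impI, elim conjE)
  fix s l assume s: "\<forall>n. s n \<in> ker_on X d" and l: "s \<longlonglongrightarrow> l"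
  interpret G: Metric_space V "graph_dist V d" by (rule Metric_space_graph_dist[OF lin])
  have "l \<in> ker_on V d"
    by (rule closed_sequentially[OF closed_kernel _ l]) (use s in \<open>auto simp: ker_on_def\<close>)
  then have l0: "l \<in> V" "d l = 0" by (auto simp: ker_on_def)
  have "graph_dist V d (s n) l = dist (s n) l" for n
    using s l0 by (simp add: graph_dist_eq_dist_Pair[OF lin] ker_on_def X_V dist_Pair_Pair)
  then have "limitin G.mtopology s l sequentially"
    using s l l0 by (auto simp: G.limitin_metric_dist_null ker_on_def tendsto_dist_iff[symmetric])
  moreover have "range s \<subseteq> X" using s by (auto simp: ker_on_def)
  ultimately have "l \<in> X"
    using closed_X unfolding graph_topology_def G.metric_closedin_iff_sequentially_closed by blast
  then show "l \<in> ker_on X d" using l0 by (simp add: ker_on_def)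
qed

text \<open>If \<open>d v\<close> lies in \<open>X\<close>, the projection fixes it and commutes
  with \<open>d\<close>, so \<open>\<pi> v\<close> is a discrete preimage. Closedness of the
  discrete range follows from this formula.\<close>

lemma range_X: "d ` X = d ` V \<inter> ker_on X d"
proof
  show "d ` V \<inter> ker_on X d \<subseteq> d ` X"
  proof
    fix b assume "b \<in> d ` V \<inter> ker_on X d"
    then obtain v where "v \<in> V" "b = d v" "b \<in> X" by (auto simp: ker_on_def)
    then have "b = d (\<pi> v)" using commute \<pi>_fix by metis
    with \<open>v \<in> V\<close> show "b \<in> d ` X" by auto
  qed
qed (auto simp: ker_on_def)

lemma closed_range_X: "closed (d ` X)"
  unfolding range_X by (intro closed_Int closed_range closed_ker_X)

lemma \<pi>_range: "b \<in> d ` V \<Longrightarrow> \<pi> b \<in> d ` X"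
  using commute by auto

section \<open>The discrete Poincare inequality and the gap between harmonic spaces\<close>

lemmas ker_X = subspace_ker_on[OF subspace_X X_sub] closed_ker_X
lemmas range_X_closed = subspace_range[OF subspace_X X_sub] closed_range_X
text \<open>Take a controlled preimage \<open>z\<close> of \<open>d x\<close>. Then
  \<open>x - \<pi> z\<close> is in the discrete kernel, to which \<open>x\<close> is orthogonal, so
  \<open>x\<close> is no longer than \<open>\<pi> z\<close>.\<close>

lemma discrete_poincare:
  assumes c: "0 \<le> c" "\<And>v. v \<in> V \<Longrightarrow> \<exists>z\<in>V. d z = d v \<and> graph_norm d z \<le> c * norm (d v)"
    and x: "x \<in> X" "\<And>z. z \<in> ker_on X d \<Longrightarrow> x \<bullet> z = 0"
  shows "norm x \<le> M * c * norm (d x)"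
proof -
  obtain z where z: "z \<in> V" "d z = d x" "graph_norm d z \<le> c * norm (d x)"
    using c(2) x(1) by blast
  have "d (\<pi> z) = d x" using z x(1) commute \<pi>_fix d_in_X by metis
  then have "x - \<pi> z \<in> ker_on X d"
    using z x(1) subspace_X by (auto simp: ker_on_def d_diff X_V \<pi>_in subspace_diff)
  then have "(norm x)\<^sup>2 = x \<bullet> \<pi> z"
    using x(2) by (fastforce simp: power2_norm_eq_inner inner_diff_right)
  also have "\<dots> \<le> norm (\<pi> z) * norm x" using norm_cauchy_schwarz[of x "\<pi> z"] by (simp add: mult.commute)
  finally have "norm x \<le> norm (\<pi> z)" by (rule norm_le_of_power2_le_mult) simp
  also have "\<dots> \<le> M * graph_norm d z"
    using bounded[OF z(1)] norm_le_graph_norm order_trans by blast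
  also have "\<dots> \<le> M * (c * norm (d x))" using z(3) M_nonneg by (rule mult_left_mono)
  finally show ?thesis by (simp add: mult.assoc)
qed

text \<open>Makes the \<open>onorm\<close> in the harmonic gap an actual bound. On harmonic elements
  the graph norm is the ambient norm, which turns the graph bound on \<open>\<pi>\<close> into a
  bound on the whole space.\<close>

lemma bounded_linear_gap:
  "bounded_linear (\<lambda>w. orth_proj (harmonic V d) w - \<pi> (orth_proj (harmonic V d) w))"
proof -
  let ?P = "orth_proj (harmonic V d)"
  interpret P: linear ?P by (rule linear_orth_proj[OF harmonic_V])
  have P: "?P w \<in> V" "d (?P w) = 0" for w
    using harmonicD[OF orth_proj_in[OF harmonic_V]] by auto
  show ?thesis
  proof (rule bounded_linear_intro)
    show "?P (v + w) - \<pi> (?P (v + w)) = ?P v - \<pi> (?P v) + (?P w - \<pi> (?P w))" for v w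
      using \<pi>_lin P by (simp add: P.add linear_map_on_def)
    show "?P (a *\<^sub>R w) - \<pi> (?P (a *\<^sub>R w)) = a *\<^sub>R (?P w - \<pi> (?P w))" for a w
      using \<pi>_lin P by (simp add: P.scale linear_map_on_def scaleR_right_diff_distrib)
    show "norm (?P w - \<pi> (?P w)) \<le> norm w * (1 + M)" for w
    proof -
      have "norm (?P w - \<pi> (?P w)) \<le> (1 + M) * graph_norm d (?P w)"
        using norm_diff_\<pi>_le[OF P(1), of 0 w] subspace_0[OF subspace_X] by simp
      also have "graph_norm d (?P w) = norm (?P w)"
        by (simp add: graph_norm_eq_norm_Pair P norm_Pair)
      also have "(1 + M) * norm (?P w) \<le> (1 + M) * norm w"
        using M_nonneg by (intro mult_left_mono norm_orth_proj_le[OF harmonic_V]) auto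
      finally show ?thesis by (simp add: mult.commute)
    qed
  qed
qed

lemma harmonic_gap_nonneg: "0 \<le> harmonic_gap V d \<pi>"
  unfolding harmonic_gap_def by (rule onorm_pos_le[OF bounded_linear_gap])

text \<open>The difference \<open>q - ?H\<close> lies in the range, so its projection
  \<open>q - \<pi> ?H\<close> lies in the discrete range and is orthogonal to both \<open>q\<close>
  and \<open>?H\<close>. This bounds \<open>q - ?H\<close> by the projection error of
  \<open>?H\<close>.\<close>

lemma discrete_harmonic_gap:
  assumes q: "q \<in> harmonic X d"
  shows "norm (q - orth_proj (harmonic V d) q) \<le> harmonic_gap V d \<pi> * norm q"
proof -
  let ?H = "orth_proj (harmonic V d) q"
  have qX: "q \<in> X" "q \<in> V" "d q = 0" using harmonicD[OF q] by auto
  have H: "?H \<in> harmonic V d" by (rule orth_proj_in[OF harmonic_V])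
  have "q - ?H \<in> d ` V"
    using orth_proj_in[OF range_V_closed, of q] by (simp add: orth_proj_harmonic qX)
  then have "\<pi> (q - ?H) \<in> d ` X" by (rule \<pi>_range)
  moreover have "\<pi> (q - ?H) = q - \<pi> ?H" using H harmonicD qX by (simp add: \<pi>_diff \<pi>_fix)
  ultimately have "q - \<pi> ?H \<in> d ` X" by simp
  then have "(q - ?H) \<bullet> (q - \<pi> ?H) = 0"
    using harmonicD[OF q] harmonicD[OF H] by (auto simp: inner_diff_left)
  then have "(norm (q - ?H))\<^sup>2 = (q - ?H) \<bullet> (\<pi> ?H - ?H)"
    by (simp add: power2_norm_eq_inner inner_diff_right)
  also have "\<dots> \<le> norm (?H - \<pi> ?H) * norm (q - ?H)"
    using norm_cauchy_schwarz[of "q - ?H" "\<pi> ?H - ?H"] by (simp add: mult.commute norm_minus_commute)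
  finally have "norm (q - ?H) \<le> norm (?H - \<pi> ?H)" by (rule norm_le_of_power2_le_mult) simp
  also have "\<dots> \<le> harmonic_gap V d \<pi> * norm q"
    unfolding harmonic_gap_def by (rule onorm[OF bounded_linear_gap])
  finally show ?thesis .
qed

text \<open>Since \<open>q - ?H\<close> is in the range, \<open>u\<close> may be replaced by its
  range part \<open>?b\<close>; since \<open>\<pi> ?b\<close> is in the discrete range, it is
  orthogonal to \<open>q\<close> and \<open>?H\<close> and may be subtracted. Both factors are then
  small.\<close>

lemma inner_discrete_harmonic_le:
  assumes u: "\<And>q. q \<in> harmonic V d \<Longrightarrow> u \<bullet> q = 0"
    and q: "q \<in> harmonic X d" and v: "v \<in> X"
  shows "\<bar>u \<bullet> q\<bar> \<le> (1 + M) * harmonic_gap V d \<pi> * graph_norm d (orth_proj (d ` V) u - v) * norm q"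
proof -
  let ?b = "orth_proj (d ` V) u" and ?H = "orth_proj (harmonic V d) q"
  have qX: "q \<in> V" "d q = 0" using harmonicD[OF q] by auto
  have H: "?H \<in> harmonic V d" by (rule orth_proj_in[OF harmonic_V])
  have b: "?b \<in> d ` V" by (rule orth_proj_in[OF range_V_closed])
  have \<pi>b: "\<pi> ?b \<in> d ` X" by (rule \<pi>_range[OF b])
  have "q - ?H \<in> d ` V"
    using orth_proj_in[OF range_V_closed, of q] by (simp add: orth_proj_harmonic qX)
  then have "u \<bullet> (q - ?H) = ?b \<bullet> (q - ?H)" by (simp add: inner_orth_proj[OF range_V_closed])
  then have "u \<bullet> q = ?b \<bullet> (q - ?H)" using u[OF H] by (simp add: inner_diff_right)
  also have "\<dots> = (?b - \<pi> ?b) \<bullet> (q - ?H)"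
    using \<pi>b harmonicD[OF q] harmonicD[OF H] by (auto simp: inner_diff_left inner_diff_right)
  also have "\<bar>\<dots>\<bar> \<le> norm (?b - \<pi> ?b) * norm (q - ?H)" by (rule Cauchy_Schwarz_ineq2)
  also have "\<dots> \<le> ((1 + M) * graph_norm d (?b - v)) * (harmonic_gap V d \<pi> * norm q)"
    using b v M_nonneg
    by (intro mult_mono norm_diff_\<pi>_le discrete_harmonic_gap[OF q]) (auto simp: graph_norm_nonneg)
  finally show ?thesis by (simp add: mult_ac)
qed

text \<open>
  The components of \<open>e\<close> along \<open>\<BB>\<^sub>h\<close>, \<open>\<HH>\<^sub>h\<close> and \<open>\<ZZ>\<^sub>h\<^sup>\<bottom>\<close> are controlled by testing with a
  preimage under \<open>d\<close>, with the component itself, and with \<open>d e\<close>, respectively.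
\<close>

lemma discrete_stability:
  assumes c: "0 \<le> c" "\<And>v. v \<in> V \<Longrightarrow> \<exists>z\<in>V. d z = d v \<and> graph_norm d z \<le> c * norm (d v)"
    and e: "e \<in> X" and s: "s \<in> harmonic X d" and \<delta>: "0 \<le> \<delta>"
    and eq: "\<And>v. v \<in> X \<Longrightarrow> d e \<bullet> v + e \<bullet> d v + s \<bullet> v = g \<bullet> v + k \<bullet> d v"
    and orth: "\<And>q. q \<in> harmonic X d \<Longrightarrow> \<bar>e \<bullet> q\<bar> \<le> \<delta> * norm q"
  shows "graph_norm d e + norm s \<le> 2 * (1 + M * c) * norm g + norm k + \<delta>"
proof -
  have sX: "s \<in> X" "d s = 0" using harmonicD[OF s] by auto
  have deX: "d e \<in> X" "d (d e) = 0" using e by auto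
  \<comment> \<open>With \<open>d e\<close> as test function, the terms containing
    \<open>d (d e)\<close> vanish and \<open>s\<close> is orthogonal to the discrete range.\<close>
  have "(norm (d e))\<^sup>2 = g \<bullet> d e"
    using eq[OF deX(1)] deX harmonicD(3)[OF s e] by (simp add: power2_norm_eq_inner)
  also have "\<dots> \<le> norm g * norm (d e)" by (rule norm_cauchy_schwarz)
  finally have de: "norm (d e) \<le> norm g" by (rule norm_le_of_power2_le_mult) simp
  have "(norm s)\<^sup>2 = g \<bullet> s"
    using eq[OF sX(1)] sX harmonicD(4)[OF s e] by (simp add: power2_norm_eq_inner)
  also have "\<dots> \<le> norm g * norm s" by (rule norm_cauchy_schwarz)
  finally have s_le: "norm s \<le> norm g" by (rule norm_le_of_power2_le_mult) simp

  \<comment> \<open>Discrete Hodge decomposition: \<open>e - z\<close> is orthogonal to the discrete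
    kernel, \<open>z - b\<close> is discretely harmonic, and \<open>b\<close> is in the discrete
    range.\<close>
  define z where "z = orth_proj (ker_on X d) e"
  define b where "b = orth_proj (d ` X) z"
  have z: "z \<in> X" "d z = 0" using orth_proj_in[OF ker_X] by (auto simp: z_def ker_on_def)
  have z_inner: "x \<in> ker_on X d \<Longrightarrow> z \<bullet> x = e \<bullet> x" for x
    unfolding z_def by (rule inner_orth_proj[OF ker_X])
  have b: "b \<in> d ` X" unfolding b_def by (rule orth_proj_in[OF range_X_closed])
  then have bX: "b \<in> ker_on X d" by (auto simp: ker_on_def)
  have ez: "norm (e - z) \<le> M * c * norm g"
  proof -
    have "norm (e - z) \<le> M * c * norm (d (e - z))"
      using e z z_inner subspace_X by (intro discrete_poincare[OF c]) (auto simp: subspace_diff inner_diff_left)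
    also have "\<dots> = M * c * norm (d e)" using e z by (simp add: d_diff X_V)
    also have "\<dots> \<le> M * c * norm g" using de c M_nonneg by (intro mult_left_mono) auto
    finally show ?thesis .
  qed
  have b_le: "norm b \<le> M * c * norm g + norm k"
  proof -
    obtain y where y: "y \<in> X" "b = d y" using b by auto
    \<comment> \<open>The preimage of \<open>b\<close> orthogonal to the discrete kernel: as a test
      function it removes the terms with \<open>d e\<close> and \<open>s\<close>, and the discrete
      Poincare inequality bounds it by \<open>b\<close>.\<close>
    define \<rho> where "\<rho> = y - orth_proj (ker_on X d) y"
    have y0: "orth_proj (ker_on X d) y \<in> X" "d (orth_proj (ker_on X d) y) = 0"
      using orth_proj_in[OF ker_X, of y] by (auto simp: ker_on_def)
    have \<rho>: "\<rho> \<in> X" "d \<rho> = b"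
      using y y0 subspace_X by (auto simp: \<rho>_def subspace_diff d_diff X_V)
    have \<rho>_orth: "\<rho> \<bullet> x = 0" if "x \<in> ker_on X d" for x
      unfolding \<rho>_def by (rule orth_proj_orthogonal[OF ker_X that])
    have "d e \<bullet> \<rho> = 0" "s \<bullet> \<rho> = 0"
      using \<rho>_orth[of "d e"] \<rho>_orth[of s] deX sX by (auto simp: ker_on_def inner_commute)
    then have "e \<bullet> b = g \<bullet> \<rho> + k \<bullet> b" using eq[OF \<rho>(1)] \<rho>(2) by simp
    moreover have "(norm b)\<^sup>2 = e \<bullet> b"
      using inner_orth_proj[OF range_X_closed b, of z] z_inner[OF bX]
      by (simp add: power2_norm_eq_inner b_def)
    ultimately have "(norm b)\<^sup>2 \<le> norm g * norm \<rho> + norm k * norm b"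
      using norm_cauchy_schwarz[of g \<rho>] norm_cauchy_schwarz[of k b] by linarith
    also have "norm g * norm \<rho> \<le> norm g * (M * c * norm b)"
      using discrete_poincare[OF c \<rho>(1) \<rho>_orth] by (intro mult_left_mono) (auto simp: \<rho>(2))
    finally have "(norm b)\<^sup>2 \<le> (M * c * norm g + norm k) * norm b" by (simp add: algebra_simps)
    then show ?thesis by (rule norm_le_of_power2_le_mult) (use c M_nonneg in auto)
  qed
  have zb: "norm (z - b) \<le> \<delta>"
  proof (rule norm_le_of_power2_le_mult[OF _ \<delta>])
    have ker: "z - b \<in> ker_on X d"
      using z bX subspace_diff[OF ker_X(1)] by (auto simp: ker_on_def)
    have "z - b \<in> harmonic X d"
      using ker orth_proj_orthogonal[OF range_X_closed, of _ z]
      by (auto simp: harmonic_def orthogonal_comp_def orthogonal_def b_def inner_commute)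
    then have "e \<bullet> (z - b) \<le> \<delta> * norm (z - b)" using orth by fastforce
    moreover have "(z - b) \<bullet> b = 0"
      using orth_proj_orthogonal[OF range_X_closed b, of z] by (simp add: b_def)
    then have "(norm (z - b))\<^sup>2 = e \<bullet> (z - b)"
      using z_inner[OF ker] by (simp add: power2_norm_eq_inner inner_diff_right inner_diff_left inner_commute)
    ultimately show "(norm (z - b))\<^sup>2 \<le> \<delta> * norm (z - b)" by simp
  qed
  have "norm e \<le> norm (e - z) + norm (z - b) + norm b"
    using norm_triangle_ineq[of "e - z" "z - b"] norm_triangle_ineq[of "e - b" b] by simp
  then have "norm e \<le> 2 * (M * c * norm g) + norm k + \<delta>" using ez zb b_le by linarith
  moreover have "2 * (1 + M * c) * norm g = 2 * norm g + 2 * (M * c * norm g)" by (simp add: algebra_simps)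
  ultimately show ?thesis using graph_norm_le_add[of d e] de s_le by linarith
qed

text \<open>Stability is applied to the discrete differences \<open>uh - w\<close> and
  \<open>ph - ps\<close>, whose residual consists of approximation errors; triangle inequalities
  then return to \<open>u\<close> and \<open>p\<close>.\<close>

lemma quasi_optimality:
  assumes c: "0 \<le> c" "\<And>v. v \<in> V \<Longrightarrow> \<exists>z\<in>V. d z = d v \<and> graph_norm d z \<le> c * norm (d v)"
    and u: "u \<in> V" "\<And>q. q \<in> harmonic V d \<Longrightarrow> u \<bullet> q = 0" and p: "p \<in> harmonic V d"
    and sol: "\<And>v. v \<in> V \<Longrightarrow> d u \<bullet> v + u \<bullet> d v + p \<bullet> v = f \<bullet> v"
    and uh: "uh \<in> X" "\<And>q. q \<in> harmonic X d \<Longrightarrow> uh \<bullet> q = 0" and ph: "ph \<in> harmonic X d"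
    and solh: "\<And>v. v \<in> X \<Longrightarrow> d uh \<bullet> v + uh \<bullet> d v + ph \<bullet> v = f \<bullet> v"
    and approx: "w \<in> X" "r \<in> X" "v \<in> X"
  shows "graph_norm d (u - uh) + norm (p - ph)
    \<le> (2 * M * c + 5) * (1 + M) * (graph_norm d (u - w) + graph_norm d (p - r)
        + harmonic_gap V d \<pi> * graph_norm d (orth_proj (d ` V) u - v))"
proof -
  define E where "E = graph_norm d (u - w)"
  define Q where "Q = graph_norm d (p - r)"
  define D where "D = harmonic_gap V d \<pi> * graph_norm d (orth_proj (d ` V) u - v)"
  have nonneg: "0 \<le> E" "0 \<le> Q" "0 \<le> D"
    by (simp_all add: E_def Q_def D_def graph_norm_nonneg harmonic_gap_nonneg)
  note pV = harmonicD[OF p]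
  define ps where "ps = orth_proj (ker_on X d) p"
  have ps_ker: "ps \<in> ker_on X d" unfolding ps_def by (rule orth_proj_in[OF ker_X])
  \<comment> \<open>Since \<open>p\<close> is orthogonal to \<open>\<BB> \<supseteq> \<BB>\<^sub>h\<close>, its projections onto \<open>\<ZZ>\<^sub>h\<close> and \<open>\<HH>\<^sub>h\<close> agree.\<close>
  have ps: "ps \<in> harmonic X d"
  proof -
    have "d x \<bullet> ps = 0" if x: "x \<in> X" for x
    proof -
      have "d x \<in> ker_on X d" using x by (auto simp: ker_on_def)
      then have "ps \<bullet> d x = p \<bullet> d x" unfolding ps_def by (rule inner_orth_proj[OF ker_X])
      then show ?thesis using pV x by (simp add: inner_commute X_V)
    qed
    then show ?thesis using ps_ker by (auto simp: harmonic_def orthogonal_comp_def orthogonal_def)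
  qed
  have \<sigma>: "norm (p - ps) \<le> (1 + M) * Q"
  proof -
    \<comment> \<open>Commutation keeps \<open>\<pi> p\<close> in the discrete kernel, so it
      competes with the best approximation \<open>ps\<close> there.\<close>
    have "d (\<pi> p) = 0"
      using pV commute[of p] \<pi>_fix[OF subspace_0[OF subspace_X]] by simp
    then have "\<pi> p \<in> ker_on X d" using pV by (auto simp: ker_on_def)
    then have "norm (p - ps) \<le> norm (p - \<pi> p)"
      unfolding ps_def by (rule norm_diff_orth_proj_le[OF ker_X])
    also have "\<dots> \<le> (1 + M) * Q" unfolding Q_def using pV approx by (intro norm_diff_\<pi>_le)
    finally show ?thesis .
  qed
  have e: "uh - w \<in> X" using uh approx subspace_X by (simp add: subspace_diff)
  have s: "ph - ps \<in> harmonic X d"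
    using ph ps subspace_diff[OF subspace_harmonic[OF subspace_X X_sub]] by blast
  have duw: "d (u - w) = d u - d w" "d (uh - w) = d uh - d w"
    using u uh approx by (auto simp: d_diff X_V)
  \<comment> \<open>The two problems are subtracted on \<open>X\<close>:
    \<open>d (u - w) + (p - ps)\<close> plays the role of \<open>g\<close> and \<open>u - w\<close>
    that of \<open>k\<close>. The last bracket is the harmonic defect, which arises because
    \<open>u\<close> need not be orthogonal to the discrete harmonic space.\<close>
  have main: "graph_norm d (uh - w) + norm (ph - ps)
    \<le> 2 * (1 + M * c) * norm (d (u - w) + (p - ps)) + norm (u - w) + (norm (u - w) + (1 + M) * D)"
  proof (rule discrete_stability[OF c e s])
    show "0 \<le> norm (u - w) + (1 + M) * D" using nonneg M_nonneg by simp
    show "d (uh - w) \<bullet> y + (uh - w) \<bullet> d y + (ph - ps) \<bullet> y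
        = (d (u - w) + (p - ps)) \<bullet> y + (u - w) \<bullet> d y" if "y \<in> X" for y
      using sol[of y] solh[of y] that unfolding duw by (simp add: X_V inner_diff_left inner_add_left)
    show "\<bar>(uh - w) \<bullet> q\<bar> \<le> (norm (u - w) + (1 + M) * D) * norm q" if q: "q \<in> harmonic X d" for q
    proof -
      have "(uh - w) \<bullet> q = (u - w) \<bullet> q - u \<bullet> q" using uh(2)[OF q] by (simp add: inner_diff_left)
      moreover have "\<bar>(u - w) \<bullet> q\<bar> \<le> norm (u - w) * norm q" by (rule Cauchy_Schwarz_ineq2)
      moreover have "\<bar>u \<bullet> q\<bar> \<le> (1 + M) * D * norm q"
        using inner_discrete_harmonic_le[OF u(2) q approx(3)] by (simp add: D_def mult.assoc)
      ultimately show ?thesis by (simp add: distrib_right)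
    qed
  qed
  have N: "norm (d (u - w) + (p - ps)) \<le> E + (1 + M) * Q"
    using norm_triangle_ineq[of "d (u - w)" "p - ps"] norm_op_le_graph_norm[of d "u - w"] \<sigma>
    by (simp add: E_def)
  have uw: "norm (u - w) \<le> E" by (simp add: E_def norm_le_graph_norm)
  define N where "N = E + (1 + M) * Q"
  have "N \<ge> 0" using nonneg M_nonneg by (simp add: N_def)
  have split: "graph_norm d (u - uh) \<le> E + graph_norm d (uh - w)"
  proof -
    have "(u - uh, d (u - uh)) = (u - w, d (u - w)) - (uh - w, d (uh - w))"
      using u uh by (simp add: duw d_diff X_V)
    then show ?thesis unfolding E_def graph_norm_eq_norm_Pair by (metis norm_triangle_ineq4)
  qed
  have "norm (p - ph) \<le> norm (p - ps) + norm (ph - ps)"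
    using norm_triangle_ineq4[of "p - ps" "ph - ps"] by simp
  \<comment> \<open>One \<open>E\<close> comes from the triangle inequality, one from
    \<open>k\<close>, and one from the harmonic defect.\<close>
  with split main have "graph_norm d (u - uh) + norm (p - ph)
      \<le> 2 * (1 + M * c) * norm (d (u - w) + (p - ps)) + 3 * E + (1 + M) * Q + (1 + M) * D"
    using uw \<sigma> by linarith
  also have "\<dots> \<le> 2 * (1 + M * c) * N + 3 * N + (1 + M) * D"
  proof -
    have "2 * (1 + M * c) * norm (d (u - w) + (p - ps)) \<le> 2 * (1 + M * c) * N"
      unfolding N_def using N c M_nonneg by (intro mult_left_mono) auto
    moreover have "3 * E + y \<le> 3 * (E + y)" if "0 \<le> y" for y using that by simp
    then have "3 * E + (1 + M) * Q \<le> 3 * N"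
      unfolding N_def using nonneg M_nonneg by simp
    ultimately show ?thesis unfolding add.assoc[of _ "3 * E"] by (intro add_mono order_refl)
  qed
  also have "\<dots> = (2 * M * c + 5) * N + 1 * ((1 + M) * D)" by (simp add: algebra_simps)
  \<comment> \<open>A common constant for all three terms: \<open>1 + M\<close> absorbs the
    projection factor in \<open>N\<close>, and \<open>2 * M * c + 5\<close> is at least 1.\<close>
  also have "\<dots> \<le> (2 * M * c + 5) * ((1 + M) * (E + Q)) + (2 * M * c + 5) * ((1 + M) * D)"
  proof (intro add_mono mult_left_mono mult_right_mono)
    have "0 \<le> M * E" "0 \<le> M * c" using nonneg M_nonneg c by simp_all
    then show "N \<le> (1 + M) * (E + Q)" "0 \<le> 2 * M * c + 5" "1 \<le> 2 * M * c + 5"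
      by (simp_all add: N_def distrib_left distrib_right)
    show "0 \<le> (1 + M) * D" using nonneg M_nonneg by simp
  qed
  finally show ?thesis unfolding E_def Q_def D_def by (simp add: algebra_simps)
qed

end

section \<open>Uniform constant over the family and passage to the infima\<close>

theorem theorem3p4:
  fixes V :: "'w::{real_inner,complete_space} set"
    and d :: "'w \<Rightarrow> 'w"
    and Vh :: "'h \<Rightarrow> 'w set"
    and \<pi> :: "'h \<Rightarrow> 'w \<Rightarrow> 'w"
  assumes "closed_nilpotent_op V d"
    and "\<And>h. subspace (Vh h)"
    and "\<And>h. Vh h \<subseteq> V"
    and "\<And>h. closedin (graph_topology V d) (Vh h)"
    and "\<And>h. d ` Vh h \<subseteq> Vh h"
    and "\<And>h. projection_onto V (Vh h) (\<pi> h)"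
    and "\<exists>M. \<forall>h. \<forall>v\<in>V. graph_norm d (\<pi> h v) \<le> M * graph_norm d v"
    and "\<And>h v. v \<in> V \<Longrightarrow> \<pi> h (d v) = d (\<pi> h v)"
  shows "\<exists>C>0. \<forall>f h u p uh ph.
      u \<in> V \<longrightarrow> p \<in> harmonic V d \<longrightarrow>
      (\<forall>v\<in>V. d u \<bullet> v + u \<bullet> d v + p \<bullet> v = f \<bullet> v) \<longrightarrow>
      (\<forall>q\<in>harmonic V d. u \<bullet> q = 0) \<longrightarrow>
      uh \<in> Vh h \<longrightarrow> ph \<in> harmonic (Vh h) d \<longrightarrow>
      (\<forall>vh\<in>Vh h. d uh \<bullet> vh + uh \<bullet> d vh + ph \<bullet> vh = f \<bullet> vh) \<longrightarrow>
      (\<forall>qh\<in>harmonic (Vh h) d. uh \<bullet> qh = 0) \<longrightarrow>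
      graph_norm d (u - uh) + norm (p - ph)
        \<le> C * ((INF v\<in>Vh h. graph_norm d (u - v))
             + (INF q\<in>Vh h. graph_norm d (p - q))
             + harmonic_gap V d (\<pi> h)
               * (INF v\<in>Vh h. graph_norm d (orth_proj (d ` V) u - v)))"
proof -
  interpret closed_nilpotent V d by standard (rule assms(1))
  obtain c where c: "0 \<le> c" "\<And>v. v \<in> V \<Longrightarrow> \<exists>z\<in>V. d z = d v \<and> graph_norm d z \<le> c * norm (d v)"
    using poincare by blast
  obtain M0 where M0: "\<And>h v. v \<in> V \<Longrightarrow> graph_norm d (\<pi> h v) \<le> M0 * graph_norm d v"
    using assms(7) by blast
  \<comment> \<open>The absolute value supplies the nonnegative bound that
    \<open>stable_subcomplex\<close> asks for, the same for every \<open>h\<close>.\<close>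
  define M where "M = \<bar>M0\<bar>"
  have M: "graph_norm d (\<pi> h v) \<le> M * graph_norm d v" if "v \<in> V" for h v
    using M0[OF that, of h] mult_right_mono[OF abs_ge_self graph_norm_nonneg, of M0 d v]
    unfolding M_def by linarith
  have sub: "stable_subcomplex V d (Vh h) (\<pi> h) M" for h
    by unfold_locales (use assms M in \<open>auto simp: M_def\<close>)
  define C where "C = (2 * M * c + 5) * (1 + M)"
  have "0 \<le> M * c" using c by (simp add: M_def)
  then have C: "0 < C" by (simp add: C_def M_def)
  show ?thesis
  proof (intro exI[of _ C] conjI allI impI C)
    fix f h u p uh ph
    assume u: "u \<in> V" and p: "p \<in> harmonic V d"
      and sol: "\<forall>v\<in>V. d u \<bullet> v + u \<bullet> d v + p \<bullet> v = f \<bullet> v" "\<forall>q\<in>harmonic V d. u \<bullet> q = 0"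
      and uh: "uh \<in> Vh h" and ph: "ph \<in> harmonic (Vh h) d"
      and solh: "\<forall>vh\<in>Vh h. d uh \<bullet> vh + uh \<bullet> d vh + ph \<bullet> vh = f \<bullet> vh"
        "\<forall>qh\<in>harmonic (Vh h) d. uh \<bullet> qh = 0"
    interpret stable_subcomplex V d "Vh h" "\<pi> h" M by (rule sub)
    let ?U = "\<lambda>w. graph_norm d (u - w)" and ?Q = "\<lambda>q. graph_norm d (p - q)"
      and ?B = "\<lambda>v. graph_norm d (orth_proj (d ` V) u - v)" and ?\<mu> = "harmonic_gap V d (\<pi> h)"
      and ?L = "graph_norm d (u - uh) + norm (p - ph)"
    have ne: "Vh h \<noteq> {}" using uh by blast
    have bound: "?L \<le> C * (?U w + ?Q q + ?\<mu> * ?B v)"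
      if "w \<in> Vh h" "q \<in> Vh h" "v \<in> Vh h" for w q v
      unfolding C_def
      by (rule quasi_optimality[where f = f]) (use c u p sol uh ph solh that in auto)
    \<comment> \<open>The approximants \<open>w\<close>, \<open>q\<close> and \<open>v\<close> are
      independent of each other, so the infima are taken in turn with the remaining ones
      fixed.\<close>
    have 1: "?L \<le> C * (?Q q + ?\<mu> * ?B v) + C * (INF w\<in>Vh h. ?U w)"
      if "q \<in> Vh h" "v \<in> Vh h" for q v
      using bound that C by (intro le_mult_cINF ne) (auto simp: graph_norm_nonneg algebra_simps)
    have 2: "?L \<le> C * ((INF w\<in>Vh h. ?U w) + ?\<mu> * ?B v) + C * (INF q\<in>Vh h. ?Q q)"
      if "v \<in> Vh h" for v
      using 1 that C by (intro le_mult_cINF ne) (auto simp: graph_norm_nonneg algebra_simps)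
    have "?L \<le> C * ((INF w\<in>Vh h. ?U w) + (INF q\<in>Vh h. ?Q q)) + (C * ?\<mu>) * (INF v\<in>Vh h. ?B v)"
      using 2 C harmonic_gap_nonneg
      by (intro le_mult_cINF ne) (auto simp: graph_norm_nonneg algebra_simps)
    then show "?L \<le> C * ((INF w\<in>Vh h. ?U w) + (INF q\<in>Vh h. ?Q q) + ?\<mu> * (INF v\<in>Vh h. ?B v))"
      by (simp add: algebra_simps)
  qed
qed

end
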